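(* Let $\mathbb{K}$ be a field of characteristic zero and let $V$ be a four-dimensional $\mathbb{K}$-vector space with basis $\{e_1,e_2,e_3,e_4\}$. For $s\in\mathbb{K}$ let $\mathfrak{A}_s=(V,\mu_s)$ be the anti-commutative algebra whose only nonzero products of basis elements (up to anti-commutativity) are $$\mu_s(e_1,e_3)=e_1,\quad \mu_s(e_1,e_4)=s e_2,\quad \mu_s(e_2,e_3)=s e_2.$$ Let $t\in\mathbb{K}$ with $t\neq 0,1$. Then $$\phi_{4,t}(\mathfrak{A}_s)=\begin{cases}6, & s=0,\\ 1, & s=t,\\ 0, & \text{otherwise,}\end{cases}$$ and consequently, for $t_1,t_2\in\mathbb{K}\setminus\{0,1\}$, the functions $\phi_{4,t_1}$ and $\phi_{4,t_2}$ are equal if and only if $t_1=t_2$.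
   Context: All algebras are finite dimensional over a field $\mathbb{K}$ of characteristic zero. An anti-commutative algebra is a vector space $V$ with a bilinear map $\mu:V\times V\to V$ satisfying $\mu(X,Y)=-\mu(Y,X)$. For constants $\alpha,\beta,\gamma\in\mathbb{K}$, an $(\alpha,\beta,\gamma)$-derivation of $(V,\mu)$ is a linear map $D:V\to V$ with $\alpha D\mu(X,Y)=\beta\mu(DX,Y)+\gamma\mu(X,DY)$ for all $X,Y\in V$; the space of these is denoted $\mathcal{D}(\alpha,\beta,\gamma)(V,\mu)$. Let $C^2(V;V)$ be the space of antisymmetric bilinear maps $V\times V\to V$ and $n=\dim V$. For $t\in\mathbb{K}$, $\phi_{n,t}:C^2(V;V)\to\{0,1,\dots,n^2\}$ is defined by $\phi_{n,t}(\mu)=\dim\mathcal{D}(t,1,0)(V,\mu)$; we write $\phi_{n,t}(\mathfrak{A})$ for $\phi_{n,t}(\mu)$ when $\mathfrak{A}=(V,\mu)$. *)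

theory Defs
  imports "HOL-Analysis.Analysis" "HOL-Library.Function_Algebras"
begin

text \<open>The ambient vector space V is 'a^'n (coordinates w.r.t. a fixed basis) over a
field 'a of characteristic zero; dim V = CARD('n).  Linear maps V \<Rightarrow> V form a
K-vector space under pointwise operations; fscale is the scalar multiplication.\<close>

definition fscale :: "'a::field \<Rightarrow> ('b \<Rightarrow> 'a^'n) \<Rightarrow> ('b \<Rightarrow> 'a^'n)" where
  "fscale c f = (\<lambda>x. c *s f x)"

interpretation fvs: vector_space "fscale :: 'a::field \<Rightarrow> ('b \<Rightarrow> 'a^'n) \<Rightarrow> ('b \<Rightarrow> 'a^'n)"
  by unfold_locales (auto simp: fscale_def fun_eq_iff vec.scale_right_distrib
      vec.scale_left_distrib)

definition lin :: "('a::field^'n \<Rightarrow> 'a^'m) \<Rightarrow> bool" where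
  "lin f = Vector_Spaces.linear (*s) (*s) f"

text \<open>Bilinear maps V \<times> V \<Rightarrow> V.\<close>
definition bilin :: "('a::field^'n \<Rightarrow> 'a^'n \<Rightarrow> 'a^'n) \<Rightarrow> bool" where
  "bilin \<mu> = ((\<forall>x. lin (\<mu> x)) \<and> (\<forall>y. lin (\<lambda>x. \<mu> x y)))"

text \<open>C^2(V;V): antisymmetric bilinear maps.\<close>
definition C2 :: "('a::field^'n \<Rightarrow> 'a^'n \<Rightarrow> 'a^'n) set" where
  "C2 = {\<mu>. bilin \<mu> \<and> (\<forall>X Y. \<mu> X Y = - \<mu> Y X)}"

text \<open>(alpha,beta,gamma)-derivations.\<close>
definition derivs :: "'a::field \<Rightarrow> 'a \<Rightarrow> 'a \<Rightarrow> ('a^'n \<Rightarrow> 'a^'n \<Rightarrow> 'a^'n)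
    \<Rightarrow> ('a^'n \<Rightarrow> 'a^'n) set" where
  "derivs \<alpha> \<beta> \<gamma> \<mu> = {D. lin D \<and>
     (\<forall>X Y. \<alpha> *s D (\<mu> X Y) = \<beta> *s \<mu> (D X) Y + \<gamma> *s \<mu> X (D Y))}"

text \<open>phi_{n,t}(mu) = dim D(t,1,0)(V,mu), with n = CARD('n).\<close>
definition phi :: "'a::field \<Rightarrow> ('a^'n \<Rightarrow> 'a^'n \<Rightarrow> 'a^'n) \<Rightarrow> nat" where
  "phi t \<mu> = fvs.dim (derivs t 1 0 \<mu>)"

text \<open>Basis e_1,e_2,e_3,e_4 of 'a^4 is axis 1, axis 2, axis 3, axis 4 (index 4 = 0 in type 4).
mu_s(e1,e3)=e1, mu_s(e1,e4)=s e2, mu_s(e2,e3)=s e2, extended bilinearly and antisymmetrically.\<close>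
definition muA :: "'a::field \<Rightarrow> 'a^4 \<Rightarrow> 'a^4 \<Rightarrow> 'a^4" where
  "muA s X Y =
     (X$1 * Y$3 - X$3 * Y$1) *s axis 1 1
   + (s * (X$1 * Y$4 - X$4 * Y$1)) *s axis 2 1
   + (s * (X$2 * Y$3 - X$3 * Y$2)) *s axis 2 1"

end

theory Submission
  imports Defs
begin

text \<open>For \<open>t \<notin> {0, 1}\<close>, writing the condition \<open>t D \<mu>\<^sub>s(X, Y) = \<mu>\<^sub>s(D X, Y)\<close> on pairs of
basis vectors gives a homogeneous linear system in the matrix entries of \<open>D\<close>.  Solving it:
for \<open>s = 0\<close> the derivations are exactly the maps killing \<open>e\<^sub>1\<close> with image in
\<open>span {e\<^sub>2, e\<^sub>4}\<close> (six free entries); for \<open>s = t\<close> they are the multiples of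
\<open>e\<^sub>1 \<mapsto> e\<^sub>2, e\<^sub>3 \<mapsto> e\<^sub>4\<close>; otherwise only \<open>D = 0\<close>.  Each solution space is the image of an
injective linear parametrisation, which gives its dimension.  Finally \<open>\<A>\<^sub>t\<^sub>1\<close> separates
\<open>\<phi>\<^sub>4\<^sub>,\<^sub>t\<^sub>1\<close> (value 1) from \<open>\<phi>\<^sub>4\<^sub>,\<^sub>t\<^sub>2\<close> (value 0) whenever \<open>t\<^sub>1 \<noteq> t\<^sub>2\<close>.\<close>

lemma exhaust_6:
  fixes x :: 6
  shows "x = 1 \<or> x = 2 \<or> x = 3 \<or> x = 4 \<or> x = 5 \<or> x = 6"
proof (induct x)
  case (of_int z)
  then have "z = 0 \<or> z = 1 \<or> z = 2 \<or> z = 3 \<or> z = 4 \<or> z = 5" by fastforce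
  then show ?case by auto
qed

lemma forall_6: "(\<forall>i::6. P i) \<longleftrightarrow> P 1 \<and> P 2 \<and> P 3 \<and> P 4 \<and> P 5 \<and> P 6"
  by (metis exhaust_6)

lemma lin_iff:
  "lin (f :: 'a::field^'n \<Rightarrow> 'a^'m) \<longleftrightarrow>
     (\<forall>x y. f (x + y) = f x + f y) \<and> (\<forall>c x. f (c *s x) = c *s f x)"
  unfolding lin_def Vector_Spaces.linear_iff[of "(*s)" "(*s)" f]
  by (simp add: vec.vector_space_axioms)

lemma lin_apply_4:
  assumes "lin (D :: 'a::field^4 \<Rightarrow> 'a^4)"
  shows "D X $ i = X$1 * D (axis 1 1) $ i + X$2 * D (axis 2 1) $ i
    + X$3 * D (axis 3 1) $ i + X$4 * D (axis 4 1) $ i"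
  using linear_componentwise[of D X i] assms unfolding lin_def sum_4 by simp

lemma linear_fscale_iff:
  "Vector_Spaces.linear (*s) fscale (L :: 'a::field^'m \<Rightarrow> 'b \<Rightarrow> 'a^'n) \<longleftrightarrow>
     (\<forall>x y. L (x + y) = L x + L y) \<and> (\<forall>c x. L (c *s x) = fscale c (L x))"
  using Vector_Spaces.linear_iff[of "(*s)" fscale L] vec.vector_space_axioms fvs.vector_space_axioms
  by blast

lemma fvs_dim_range_inj:
  assumes "Vector_Spaces.linear (*s) fscale (L :: 'a::field^'m \<Rightarrow> 'b \<Rightarrow> 'a^'n)" and "inj L"
  shows "fvs.dim (range L) = CARD('m)"
proof -
  interpret pair: finite_dimensional_vector_space_pair_1
    "(*s) :: 'a \<Rightarrow> 'a^'m \<Rightarrow> 'a^'m" cart_basis "fscale :: 'a \<Rightarrow> ('b \<Rightarrow> 'a^'n) \<Rightarrow> _"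
    by unfold_locales
  have "fvs.dim (range L) = vec.dim (UNIV :: ('a^'m) set)"
    using pair.dim_image_eq[OF assms(1)] assms(2) by (simp add: inj_on_def inj_def)
  then show ?thesis by (simp add: card_cart_basis)
qed

lemma fvs_dim_zero: "fvs.dim {0 :: 'b \<Rightarrow> 'a::field^'n} = 0"
  by (metis fvs.dim_eq_card_independent fvs.independent_empty card.empty fvs.dim_span
      fvs.span_insert_0)

lemma derivs_t10_component:
  assumes "D \<in> derivs t 1 0 \<mu>"
  shows "t * D (\<mu> X Y) $ i = \<mu> (D X) Y $ i"
proof -
  have "t *s D (\<mu> X Y) = \<mu> (D X) Y" using assms by (simp add: derivs_def)
  then show ?thesis by (metis vector_smult_component)
qed

definition derivs0_param :: "'a::field^6 \<Rightarrow> 'a^4 \<Rightarrow> 'a^4" where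
  "derivs0_param c X =
     (c$1 * X$2 + c$2 * X$3 + c$3 * X$4) *s axis 2 1 + (c$4 * X$2 + c$5 * X$3 + c$6 * X$4) *s axis 4 1"

definition derivs_diag_param :: "'a::field^1 \<Rightarrow> 'a^4 \<Rightarrow> 'a^4" where
  "derivs_diag_param c X = (c$1 * X$1) *s axis 2 1 + (c$1 * X$3) *s axis 4 1"

lemma linear_derivs0_param: "Vector_Spaces.linear (*s) fscale (derivs0_param :: 'a::field^6 \<Rightarrow> _)"
  unfolding linear_fscale_iff
  by (auto simp: derivs0_param_def fscale_def fun_eq_iff vec_eq_iff algebra_simps)

lemma linear_derivs_diag_param:
  "Vector_Spaces.linear (*s) fscale (derivs_diag_param :: 'a::field^1 \<Rightarrow> _)"
  unfolding linear_fscale_iff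
  by (auto simp: derivs_diag_param_def fscale_def fun_eq_iff vec_eq_iff algebra_simps)

lemma inj_derivs0_param: "inj (derivs0_param :: 'a::field^6 \<Rightarrow> _)"
proof (rule injI)
  fix c d :: "'a^6"
  assume "derivs0_param c = derivs0_param d"
  then have "\<And>X i. derivs0_param c X $ i = derivs0_param d X $ i" by simp
  from this[of "axis 2 1" 2] this[of "axis 3 1" 2] this[of "axis 4 1" 2]
    this[of "axis 2 1" 4] this[of "axis 3 1" 4] this[of "axis 4 1" 4]
  show "c = d" unfolding vec_eq_iff forall_6 by (simp add: derivs0_param_def axis_def)
qed

lemma inj_derivs_diag_param: "inj (derivs_diag_param :: 'a::field^1 \<Rightarrow> _)"
proof (rule injI)
  fix c d :: "'a^1"
  assume "derivs_diag_param c = derivs_diag_param d"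
  then have "derivs_diag_param c (axis 1 1) $ 2 = derivs_diag_param d (axis 1 1) $ 2" by simp
  then show "c = d" unfolding vec_eq_iff by (simp add: derivs_diag_param_def axis_def)
qed

lemma derivs_muA_0:
  fixes t :: "'a::field_char_0"
  assumes "t \<noteq> 0" and "t \<noteq> 1"
  shows "derivs t 1 0 (muA 0) = range derivs0_param"
proof
  show "derivs t 1 0 (muA 0) \<subseteq> range derivs0_param"
  proof
    fix D
    assume D: "D \<in> derivs t 1 0 (muA 0)"
    define M where "M i j = D (axis j 1) $ i" for i j
    have DX: "D X $ i = X$1 * M i 1 + X$2 * M i 2 + X$3 * M i 3 + X$4 * M i 4" for X i
      unfolding M_def using D by (intro lin_apply_4) (simp add: derivs_def)
    have "\<forall>a b i. t * D (muA 0 (axis a 1) (axis b 1)) $ i = muA 0 (D (axis a 1)) (axis b 1) $ i"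
      using derivs_t10_component[OF D] by blast
    then have E: "M 1 1 = 0 \<and> M 2 1 = 0 \<and> M 3 1 = 0 \<and> M 4 1 = 0 \<and> M 1 2 = 0 \<and> M 3 2 = 0
        \<and> M 1 3 = 0 \<and> M 3 3 = 0 \<and> M 1 4 = 0 \<and> M 3 4 = 0"
      unfolding forall_4 using assms by (auto simp: DX muA_def axis_def)
    define c :: "'a^6" where "c = (\<chi> k. if k = 1 then M 2 2 else if k = 2 then M 2 3
      else if k = 3 then M 2 4 else if k = 4 then M 4 2 else if k = 5 then M 4 3 else M 4 4)"
    have "D = derivs0_param c"
      using E by (auto simp: fun_eq_iff vec_eq_iff forall_4 DX derivs0_param_def c_def axis_def)
    then show "D \<in> range derivs0_param" by blast
  qed
  show "range derivs0_param \<subseteq> derivs t 1 0 (muA 0)"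
  proof (clarsimp simp: derivs_def)
    fix c :: "'a^6"
    show "lin (derivs0_param c) \<and> (\<forall>X Y. t *s derivs0_param c (muA 0 X Y) = muA 0 (derivs0_param c X) Y)"
      unfolding lin_iff
      by (auto simp: derivs0_param_def muA_def vec_eq_iff forall_4 axis_def algebra_simps)
  qed
qed

lemma derivs_muA_diag:
  fixes t :: "'a::field_char_0"
  assumes "t \<noteq> 0" and "t \<noteq> 1"
  shows "derivs t 1 0 (muA t) = range derivs_diag_param"
proof
  show "derivs t 1 0 (muA t) \<subseteq> range derivs_diag_param"
  proof
    fix D
    assume D: "D \<in> derivs t 1 0 (muA t)"
    define M where "M i j = D (axis j 1) $ i" for i j
    have DX: "D X $ i = X$1 * M i 1 + X$2 * M i 2 + X$3 * M i 3 + X$4 * M i 4" for X i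
      unfolding M_def using D by (intro lin_apply_4) (simp add: derivs_def)
    have "\<forall>a b i. t * D (muA t (axis a 1) (axis b 1)) $ i = muA t (D (axis a 1)) (axis b 1) $ i"
      using derivs_t10_component[OF D] by blast
    then have E: "M 1 1 = 0 \<and> M 3 1 = 0 \<and> M 4 1 = 0 \<and> M 1 2 = 0 \<and> M 2 2 = 0 \<and> M 3 2 = 0
        \<and> M 4 2 = 0 \<and> M 1 3 = 0 \<and> M 2 3 = 0 \<and> M 3 3 = 0 \<and> M 4 3 = M 2 1
        \<and> M 1 4 = 0 \<and> M 2 4 = 0 \<and> M 3 4 = 0 \<and> M 4 4 = 0"
      unfolding forall_4 using assms by (auto simp: DX muA_def axis_def)
    then have "D = derivs_diag_param (\<chi> _. M 2 1)"
      by (auto simp: fun_eq_iff vec_eq_iff forall_4 DX derivs_diag_param_def axis_def)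
    then show "D \<in> range derivs_diag_param" by blast
  qed
  show "range derivs_diag_param \<subseteq> derivs t 1 0 (muA t)"
  proof (clarsimp simp: derivs_def)
    fix c :: "'a^1"
    show "lin (derivs_diag_param c)
        \<and> (\<forall>X Y. t *s derivs_diag_param c (muA t X Y) = muA t (derivs_diag_param c X) Y)"
      unfolding lin_iff
      by (auto simp: derivs_diag_param_def muA_def vec_eq_iff forall_4 axis_def algebra_simps)
  qed
qed

lemma derivs_muA_generic:
  fixes s t :: "'a::field_char_0"
  assumes "t \<noteq> 0" and "t \<noteq> 1" and "s \<noteq> 0" and "s \<noteq> t"
  shows "derivs t 1 0 (muA s) = {0}"
proof
  show "derivs t 1 0 (muA s) \<subseteq> {0}"
  proof
    fix D
    assume D: "D \<in> derivs t 1 0 (muA s)"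
    define M where "M i j = D (axis j 1) $ i" for i j
    have DX: "D X $ i = X$1 * M i 1 + X$2 * M i 2 + X$3 * M i 3 + X$4 * M i 4" for X i
      unfolding M_def using D by (intro lin_apply_4) (simp add: derivs_def)
    have "\<forall>a b i. t * D (muA s (axis a 1) (axis b 1)) $ i = muA s (D (axis a 1)) (axis b 1) $ i"
      using derivs_t10_component[OF D] by blast
    then have "M 1 1 = 0 \<and> M 2 1 = 0 \<and> M 3 1 = 0 \<and> M 4 1 = 0 \<and> M 1 2 = 0 \<and> M 2 2 = 0
        \<and> M 3 2 = 0 \<and> M 4 2 = 0 \<and> M 1 3 = 0 \<and> M 2 3 = 0 \<and> M 3 3 = 0 \<and> M 4 3 = 0
        \<and> M 1 4 = 0 \<and> M 2 4 = 0 \<and> M 3 4 = 0 \<and> M 4 4 = 0"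
      unfolding forall_4 using assms by (auto simp: DX muA_def axis_def)
    then show "D \<in> {0}"
      by (auto simp: fun_eq_iff vec_eq_iff forall_4 DX)
  qed
  show "{0} \<subseteq> derivs t 1 0 (muA s)"
    by (auto simp: derivs_def lin_iff muA_def)
qed

lemma phi_muA:
  fixes s t :: "'a::field_char_0"
  assumes "t \<noteq> 0" and "t \<noteq> 1"
  shows "phi t (muA s) = (if s = 0 then 6 else if s = t then 1 else 0)"
  using derivs_muA_0[OF assms] derivs_muA_diag[OF assms] derivs_muA_generic[OF assms, of s]
    fvs_dim_range_inj[OF linear_derivs0_param inj_derivs0_param]
    fvs_dim_range_inj[OF linear_derivs_diag_param inj_derivs_diag_param] fvs_dim_zero
  by (auto simp: phi_def)

lemma muA_in_C2: "muA s \<in> C2"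
  unfolding C2_def bilin_def lin_iff
  by (auto simp: muA_def vec_eq_iff forall_4 axis_def algebra_simps)

theorem proposition2p1:
  fixes s t :: "'a::field_char_0"
  assumes "t \<noteq> 0" and "t \<noteq> 1"
  shows "phi t (muA s) = (if s = 0 then 6 else if s = t then 1 else 0)
    \<and> (\<forall>t1 t2 :: 'a. t1 \<notin> {0, 1} \<longrightarrow> t2 \<notin> {0, 1} \<longrightarrow>
           ((\<forall>\<mu> \<in> (C2 :: ('a^4 \<Rightarrow> 'a^4 \<Rightarrow> 'a^4) set). phi t1 \<mu> = phi t2 \<mu>) \<longleftrightarrow> t1 = t2))"
proof (intro conjI allI impI iffI)
  show "phi t (muA s) = (if s = 0 then 6 else if s = t then 1 else 0)"
    using phi_muA[OF assms] .
next
  fix t1 t2 :: 'a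
  assume t1: "t1 \<notin> {0, 1}" and t2: "t2 \<notin> {0, 1}"
    and same_phi: "\<forall>\<mu> \<in> (C2 :: ('a^4 \<Rightarrow> 'a^4 \<Rightarrow> 'a^4) set). phi t1 \<mu> = phi t2 \<mu>"
  have "phi t1 (muA t1) = 1" using phi_muA[of t1 t1] t1 by simp
  moreover have "phi t2 (muA t1) = (if t1 = t2 then 1 else 0)" using phi_muA[of t2 t1] t1 t2 by auto
  moreover have "phi t1 (muA t1) = phi t2 (muA t1)" using same_phi muA_in_C2 by blast
  ultimately show "t1 = t2" by (metis zero_neq_one)
qed simp

end
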